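(* Assume the Continuum Hypothesis. Let $X$ be a weakly compactly generated (WCG) real Banach space with $\operatorname{dens} X = \omega_1$. Then $X$ contains a relatively weakly compact overcomplete set.
   Context: A Banach space is WCG if it contains a linearly dense, weakly compact subset. $\operatorname{dens}$ denotes the density character. A subset $S$ of a Banach space $X$ with $|S| = \operatorname{dens} X$ is called overcomplete if every subset $\Lambda \subseteq S$ with $|\Lambda| = |S|$ is linearly dense in $X$. *)

theory Defs
  imports "HOL-Analysis.Analysis"
begin

abbreviation omega1 :: "nat set rel" where
  "omega1 \<equiv> cardSuc natLeq"

definition CH :: bool where
  "CH \<longleftrightarrow> ordIso2 (card_of (UNIV :: real set)) omega1"

definition weak_topology :: "'a::real_normed_vector topology" where
  "weak_topology = topology_generated_by
     {f -` U | (f :: 'a \<Rightarrow> real) U. bounded_linear f \<and> open U}"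

definition linearly_dense :: "'a::real_normed_vector set \<Rightarrow> bool" where
  "linearly_dense S \<longleftrightarrow> closure (span S) = UNIV"

definition WCG :: "'a::real_normed_vector itself \<Rightarrow> bool" where
  "WCG _ \<longleftrightarrow> (\<exists>K :: 'a set. compactin weak_topology K \<and> linearly_dense K)"

definition dens_eq_omega1 :: "'a::metric_space itself \<Rightarrow> bool" where
  "dens_eq_omega1 _ \<longleftrightarrow>
     (\<exists>D :: 'a set. closure D = UNIV \<and> ordIso2 (card_of D) omega1) \<and>
     (\<forall>D :: 'a set. closure D = UNIV \<longrightarrow> ordLeq2 omega1 (card_of D))"

text \<open>Overcomplete set (in a space with dens X = omega_1): |S| = dens X and every
  subset of S of the same cardinality as S is linearly dense.\<close>
definition overcomplete :: "'a::real_normed_vector set \<Rightarrow> bool" where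
  "overcomplete S \<longleftrightarrow> ordIso2 (card_of S) omega1 \<and>
     (\<forall>L \<subseteq> S. ordIso2 (card_of L) (card_of S) \<longrightarrow> linearly_dense L)"

definition rel_weakly_compact :: "'a::real_normed_vector set \<Rightarrow> bool" where
  "rel_weakly_compact S \<longleftrightarrow> compactin weak_topology (weak_topology closure_of S)"

end

theory Submission
  imports Defs "HOL-Complex_Analysis.Conformal_Mappings"
begin

text \<open>Let \<open>K\<close> be weakly compact and linearly dense. Under CH the space has only continuum many points, and
  so does its dual: countably many of the continuum many open sets of a Hausdorff topology on \<open>K\<close>
  given by point-separating functionals determine \<open>f\<close> on \<open>K\<close>. Hence the nonzero functionals can be
  indexed by \<open>\<omega>\<^sub>1\<close>, and it suffices to choose recursively, inside one weakly compact set \<open>W\<close>, distinct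
  points \<open>s\<^sub>\<alpha>\<close> on which \<open>f\<^sub>\<beta>\<close> does not vanish for \<open>\<beta> \<le> \<alpha>\<close>: a functional then vanishes on only countably
  many of them. For \<open>W\<close> take all sums \<open>\<Sum>n. t ^ (n+1) *\<^sub>R k\<^sub>n\<close> with \<open>t \<in> [0, 1/2]\<close> and \<open>k\<^sub>n \<in> K\<close>. Given countably many
  nonzero \<open>f\<^sub>n\<close>, choose \<open>k\<^sub>n\<close> with \<open>f\<^sub>n k\<^sub>n \<noteq> 0\<close>; each \<open>f\<^sub>n\<close> of the sum is a nonconstant power series in \<open>t\<close>,
  so all but countably many \<open>t\<close> avoid countably many prescribed values.\<close>

section \<open>The Hahn--Banach theorem\<close>

text \<open>Scaling only asks for \<le>: scaling back by \<open>1/c\<close> gives equality, so for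
  an infimum of such functionals a single inequality has to be checked.\<close>

definition sublinear :: "('a::real_vector \<Rightarrow> real) \<Rightarrow> bool" where
  "sublinear p \<longleftrightarrow> (\<forall>x y. p (x + y) \<le> p x + p y) \<and> (\<forall>c\<ge>0. \<forall>x. p (c *\<^sub>R x) \<le> c * p x)"

lemma sublinear_add: "sublinear p \<Longrightarrow> p (x + y) \<le> p x + p y"
  by (simp add: sublinear_def)

lemma sublinear_scaleR:
  assumes "sublinear p" "c \<ge> 0" shows "p (c *\<^sub>R x) = c * p x"
proof (rule antisym)
  show "p (c *\<^sub>R x) \<le> c * p x"
    using assms by (simp add: sublinear_def)
  show "c * p x \<le> p (c *\<^sub>R x)"
  proof (cases "c = 0")
    case True
    have "p (0 + 0) \<le> p 0 + p 0" using assms(1) by (rule sublinear_add)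
    with True show ?thesis by simp
  next
    case False
    have "p ((1/c) *\<^sub>R c *\<^sub>R x) \<le> 1/c * p (c *\<^sub>R x)"
      using assms unfolding sublinear_def by (metis divide_nonneg_nonneg zero_le_one)
    then show ?thesis using False assms(2) by (simp add: field_simps)
  qed
qed

lemma sublinear_0: "sublinear p \<Longrightarrow> p 0 = 0"
  using sublinear_scaleR[of p 0 0] by simp

lemma sublinear_ge_minus: "sublinear p \<Longrightarrow> - p (- x) \<le> p x"
  using sublinear_add[of p x "- x"] sublinear_0[of p] by simp

text \<open>If \<open>p\<close> is minimal among sublinear functionals then \<open>q = p\<close>, and the last bound says that \<open>p\<close> is odd.\<close>
lemma sublinear_tilt:
  assumes p: "sublinear p"
  obtains q where "sublinear q" "\<And>y. q y \<le> p y" "q (- x) \<le> - p x"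
proof -
  \<comment> \<open>In the infimum over \<open>t\<close>, the choice \<open>t = 0\<close> gives
    \<open>q \<le> p\<close>, and \<open>t = 1\<close> at \<open>- x\<close> gives
    \<open>p 0 - p x = - p x\<close>.\<close>
  define h where "h y t = p (y + t *\<^sub>R x) - t * p x" for y t
  define q where "q y = (INF t\<in>{0..}. h y t)" for y
  have lower: "- p (- y) \<le> h y t" if "t \<ge> 0" for y t
    using sublinear_add[OF p, of "y + t *\<^sub>R x" "- y"] sublinear_scaleR[OF p that, of x]
    by (simp add: h_def)
  have bdd: "bdd_below (h y ` {0..})" for y
    using lower by (intro bdd_belowI[of _ "- p (- y)"]) auto
  have q_le: "q y \<le> h y t" if "t \<ge> 0" for y t
    unfolding q_def using bdd that by (intro cINF_lower) auto
  have q_ge: "m \<le> q y" if "\<And>t. t \<ge> 0 \<Longrightarrow> m \<le> h y t" for m y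
    unfolding q_def using that by (intro cINF_greatest) auto
  have "q (y + z) \<le> q y + q z" for y z
  proof -
    have "q (y + z) \<le> h y s + h z t" if "s \<ge> 0" "t \<ge> 0" for s t
    proof -
      have "q (y + z) \<le> h (y + z) (s + t)" using q_le that by simp
      also have "\<dots> \<le> h y s + h z t"
        using sublinear_add[OF p, of "y + s *\<^sub>R x" "z + t *\<^sub>R x"]
        by (simp add: h_def algebra_simps)
      finally show ?thesis .
    qed
    \<comment> \<open>The infima over \<open>t\<close> and over \<open>s\<close> are taken one after
      the other.\<close>
    then have "q (y + z) - h y s \<le> q z" if "s \<ge> 0" for s
      using that by (intro q_ge) (simp add: algebra_simps)
    then have "q (y + z) - q z \<le> q y"
      by (intro q_ge) (simp add: algebra_simps)
    then show ?thesis by simp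
  qed
  moreover have "q (c *\<^sub>R y) \<le> c * q y" if "c \<ge> 0" for c y
  proof (cases "c = 0")
    case True
    then show ?thesis using q_le[of 0 0] sublinear_0[OF p] by (simp add: h_def)
  next
    case False
    have "q (c *\<^sub>R y) / c \<le> h y t" if "t \<ge> 0" for t
    proof -
      have "q (c *\<^sub>R y) \<le> h (c *\<^sub>R y) (c * t)" using q_le that \<open>c \<ge> 0\<close> by simp
      also have "\<dots> = c * h y t"
        using sublinear_scaleR[OF p \<open>c \<ge> 0\<close>, of "y + t *\<^sub>R x"]
        by (simp add: h_def algebra_simps)
      finally show ?thesis using False \<open>c \<ge> 0\<close> by (simp add: field_simps)
    qed
    then have "q (c *\<^sub>R y) / c \<le> q y" by (rule q_ge)
    then show ?thesis using False \<open>c \<ge> 0\<close> by (simp add: field_simps)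
  qed
  ultimately have "sublinear q" by (simp add: sublinear_def)
  moreover have "q y \<le> p y" for y
    using q_le[of 0 y] by (simp add: h_def)
  moreover have "q (- x) \<le> - p x"
    using q_le[of 1 "- x"] sublinear_0[OF p] by (simp add: h_def)
  ultimately show ?thesis by (rule that)
qed

text \<open>Minimality and tilting make \<open>p\<close> odd. Subadditivity at \<open>- x\<close>,
  \<open>- y\<close> then yields the reverse inequality, and negative scalars reduce to positive
  ones.\<close>

lemma linear_if_minimal_sublinear:
  assumes p: "sublinear p"
    and min: "\<And>q. sublinear q \<Longrightarrow> (\<And>y. q y \<le> p y) \<Longrightarrow> q = p"
  shows "linear p"
proof -
  have minus: "p (- x) = - p x" for x
  proof -
    obtain q where "sublinear q" "\<And>y. q y \<le> p y" "q (- x) \<le> - p x"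
      using sublinear_tilt[OF p] by blast
    with min have "p (- x) \<le> - p x" by metis
    moreover have "- p x \<le> p (- x)" using sublinear_ge_minus[OF p, of "- x"] by simp
    ultimately show ?thesis by simp
  qed
  show ?thesis
  proof (rule linearI)
    show "p (x + y) = p x + p y" for x y
      using sublinear_add[OF p, of x y] sublinear_add[OF p, of "- x" "- y"] minus[of "x + y"]
      by (simp add: minus)
    show "p (c *\<^sub>R x) = c *\<^sub>R p x" for c x
    proof (cases "c \<ge> 0")
      case False
      then have "p (- ((- c) *\<^sub>R x)) = - ((- c) * p x)"
        unfolding minus using sublinear_scaleR[OF p, of "- c" x] by simp
      then show ?thesis by simp
    qed (simp add: sublinear_scaleR[OF p])
  qed
qed

text \<open>Zorn's lemma gives a minimal sublinear functional below \<open>p\<close>, and minimal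
  ones are linear. A chain is bounded by its pointwise infimum, which is finite because
  \<open>- p (- y)\<close> bounds every member at \<open>y\<close> from below.\<close>

theorem sublinear_dominates_linear:
  assumes p: "sublinear p"
  obtains f where "linear f" "\<And>y. f y \<le> p y"
proof -
  define A where "A = {q. sublinear q \<and> (\<forall>y. q y \<le> p y)}"
  \<comment> \<open>The order is reversed, so that a maximal element for \<open>P\<close> is a
    minimal functional.\<close>
  define P where "P q r \<longleftrightarrow> (\<forall>y. r y \<le> q y)" for q r :: "'a \<Rightarrow> real"
  have "\<exists>m\<in>A. \<forall>a\<in>A. P m a \<longrightarrow> a = m"
  proof (rule predicate_Zorn)
    have "antisym (relation_of P A)"
      by (rule antisymI) (auto simp: relation_of_def P_def intro!: ext antisym)
    then show "partial_order_on A (relation_of P A)"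
      unfolding partial_order_on_def preorder_on_def
      by (auto simp: refl_on_def trans_def relation_of_def P_def intro: order_trans)
    fix C assume C: "C \<in> Chains (relation_of P A)"
    show "\<exists>u\<in>A. \<forall>a\<in>C. P a u"
    proof (cases "C = {}")
      case True
      then show ?thesis using p by (auto simp: A_def)
    next
      case False
      have CA: "sublinear q" "q y \<le> p y" if "q \<in> C" for q y
        using C that by (auto simp: Chains_def relation_of_def A_def)
      define u where "u y = (INF q\<in>C. q y)" for y
      have "- p (- y) \<le> q y" if "q \<in> C" for q y
        using sublinear_ge_minus[OF CA(1), OF that, of y] CA(2)[OF that, of "- y"] by simp
      then have bdd: "bdd_below ((\<lambda>q. q y) ` C)" for y
        by (intro bdd_belowI[of _ "- p (- y)"]) auto
      have u_le: "u y \<le> q y" if "q \<in> C" for q y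
        unfolding u_def using bdd that by (intro cINF_lower)
      have u_ge: "m \<le> u y" if "\<And>q. q \<in> C \<Longrightarrow> m \<le> q y" for m y
        unfolding u_def using that False by (intro cINF_greatest) auto
      have "u (x + y) \<le> u x + u y" for x y
      proof -
        \<comment> \<open>Two members of a chain are comparable, so the smaller one can be used at
          both \<open>x\<close> and \<open>y\<close>.\<close>
        have le: "u (x + y) \<le> q x + r y" if q: "q \<in> C" and r: "r \<in> C" for q r
        proof -
          have "P q r \<or> P r q" using C q r by (auto simp: Chains_def relation_of_def)
          then show ?thesis
            using u_le[OF q, of "x + y"] u_le[OF r, of "x + y"] sublinear_add[OF CA(1)[OF q], of x y]
              sublinear_add[OF CA(1)[OF r], of x y]
            unfolding P_def by (smt (verit))
        qed
        have "u (x + y) - q x \<le> u y" if "q \<in> C" for q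
          using le[OF that] by (intro u_ge) (simp add: diff_le_eq add.commute)
        then have "u (x + y) - u y \<le> u x"
          by (intro u_ge) (simp add: algebra_simps)
        then show ?thesis by simp
      qed
      moreover have "u (c *\<^sub>R y) \<le> c * u y" if "c \<ge> 0" for c y
      proof (cases "c = 0")
        case True
        obtain q where "q \<in> C" using False by blast
        then show ?thesis using True u_le[of q 0] sublinear_0[OF CA(1)] by fastforce
      next
        case c: False
        have "u (c *\<^sub>R y) / c \<le> u y"
        proof (rule u_ge)
          fix q assume q: "q \<in> C"
          then show "u (c *\<^sub>R y) / c \<le> q y"
            using u_le[OF q, of "c *\<^sub>R y"] sublinear_scaleR[OF CA(1)[OF q] \<open>c \<ge> 0\<close>, of y] c \<open>c \<ge> 0\<close>
            by (simp add: field_simps)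
        qed
        then show ?thesis using c \<open>c \<ge> 0\<close> by (simp add: field_simps)
      qed
      ultimately have "sublinear u" by (simp add: sublinear_def)
      moreover have "u y \<le> p y" for y
        using False u_le CA(2) by (meson all_not_in_conv order_trans)
      ultimately show ?thesis using u_le by (auto simp: A_def P_def)
    qed
  qed
  then obtain m where m: "m \<in> A" "\<And>a. a \<in> A \<Longrightarrow> P m a \<Longrightarrow> a = m" by blast
  have "linear m"
  proof (rule linear_if_minimal_sublinear)
    show "sublinear m" using m(1) by (simp add: A_def)
    fix q assume q: "sublinear q" "\<And>y. q y \<le> m y"
    have "q \<in> A" using q m(1) by (auto simp: A_def intro: order_trans)
    then show "q = m" using m(2) q(2) by (simp add: P_def)
  qed
  then show ?thesis using m(1) by (intro that) (auto simp: A_def)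
qed

text \<open>Tilting \<open>p\<close> at \<open>x\<close> before dominating forces
  \<open>f (- x) \<le> - p x\<close>, which is the missing inequality
  \<open>p x \<le> f x\<close>.\<close>

theorem Hahn_Banach_sublinear:
  assumes p: "sublinear p"
  obtains f where "linear f" "\<And>y. f y \<le> p y" "f x = p x"
proof -
  obtain q where q: "sublinear q" "\<And>y. q y \<le> p y" "q (- x) \<le> - p x"
    using sublinear_tilt[OF p] by blast
  obtain f where f: "linear f" "\<And>y. f y \<le> q y"
    using sublinear_dominates_linear[OF q(1)] by blast
  have "f y \<le> p y" for y using f(2) q(2) order_trans by blast
  moreover have "f x = p x"
    using f(2)[of "- x"] q(3) linear_neg[OF f(1), of x] calculation[of x] by linarith
  ultimately show ?thesis using f(1) that by blast
qed

section \<open>Distance to a subspace and functionals vanishing on it\<close>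

lemma sublinear_infdist_subspace:
  fixes M :: "'a::real_normed_vector set"
  assumes M: "subspace M"
  shows "sublinear (\<lambda>x. infdist x M)"
proof -
  have ne: "M \<noteq> {}" using M subspace_0 by blast
  have approx: "\<exists>a\<in>M. dist x a < infdist x M + e" if "e > 0" for x e
  proof (rule ccontr)
    assume "\<not> ?thesis"
    then have "infdist x M + e \<le> infdist x M"
      using ne unfolding infdist_notempty[OF ne] by (intro cINF_greatest) (auto simp: not_less)
    with that show False by simp
  qed
  have "infdist (x + y) M \<le> infdist x M + infdist y M" for x y
  proof (rule field_le_epsilon)
    fix e :: real assume "e > 0"
    then obtain a b where ab: "a \<in> M" "dist x a < infdist x M + e/2" "b \<in> M" "dist y b < infdist y M + e/2"
      using approx[of "e/2"] by (meson half_gt_zero)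
    have "infdist (x + y) M \<le> dist (x + y) (a + b)"
      using ab M by (intro infdist_le) (auto intro: subspace_add)
    also have "\<dots> \<le> dist x a + dist y b" by (rule dist_triangle_add)
    finally show "infdist (x + y) M \<le> infdist x M + infdist y M + e" using ab by simp
  qed
  moreover have "infdist (c *\<^sub>R x) M \<le> c * infdist x M" if "c \<ge> 0" for c x
  proof (cases "c = 0")
    case True
    then show ?thesis using M by (simp add: subspace_0)
  next
    case False
    have "infdist (c *\<^sub>R x) M / c \<le> dist x a" if "a \<in> M" for a
    proof -
      have "infdist (c *\<^sub>R x) M \<le> dist (c *\<^sub>R x) (c *\<^sub>R a)"
        using that M by (intro infdist_le) (auto intro: subspace_scale)
      also have "\<dots> = c * dist x a" using \<open>c \<ge> 0\<close>
        by (simp add: dist_norm flip: scaleR_diff_right)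
      finally show ?thesis using False \<open>c \<ge> 0\<close> by (simp add: field_simps)
    qed
    then have "infdist (c *\<^sub>R x) M / c \<le> infdist x M"
      unfolding infdist_notempty[OF ne, of x] using ne by (intro cINF_greatest) auto
    then show ?thesis using False \<open>c \<ge> 0\<close> by (simp add: field_simps)
  qed
  ultimately show ?thesis by (simp add: sublinear_def)
qed

text \<open>The distance to \<open>M\<close> is sublinear, at most the norm, and zero on
  \<open>M\<close>. Domination by it at both \<open>y\<close> and \<open>- y\<close> gives the norm
  bound and the vanishing on \<open>M\<close>.\<close>

theorem Hahn_Banach_infdist:
  fixes x :: "'a::real_normed_vector"
  assumes M: "subspace M"
  obtains f where "bounded_linear f" "\<And>y. \<bar>f y\<bar> \<le> norm y" "\<And>y. y \<in> M \<Longrightarrow> f y = 0" "f x = infdist x M"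
proof -
  obtain f where f: "linear f" "\<And>y. f y \<le> infdist y M" "f x = infdist x M"
    using Hahn_Banach_sublinear[OF sublinear_infdist_subspace[OF M]] by metis
  have "infdist y M \<le> norm y" for y
    using infdist_le[OF subspace_0[OF M], of y] by simp
  then have bound: "\<bar>f y\<bar> \<le> norm y" for y
    using f(2)[of y] f(2)[of "- y"] linear_neg[OF f(1), of y] by (smt (verit) norm_minus_cancel)
  moreover have "f y = 0" if "y \<in> M" for y
    using f(2)[of y] f(2)[of "- y"] linear_neg[OF f(1), of y] that M subspace_neg[OF M that]
    by simp
  moreover have "bounded_linear f"
    using f(1) bound by (auto intro!: bounded_linear_intro[of f 1] simp: linear_add linear_scale)
  ultimately show ?thesis using f(3) that by blast
qed

corollary Hahn_Banach_norm:
  fixes x :: "'a::real_normed_vector"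
  obtains f where "bounded_linear f" "\<And>y. \<bar>f y\<bar> \<le> norm y" "f x = norm x"
  using Hahn_Banach_infdist[OF subspace_single_0, of x] by (metis dist_0_norm dist_commute infdist_singleton)

text \<open>A point outside the closed span has positive distance from the span, and this distance
  is the value of the functional there.\<close>

corollary ex_functional_annihilating:
  fixes S :: "'a::real_normed_vector set"
  assumes "\<not> linearly_dense S"
  obtains f :: "'a \<Rightarrow> real" where "bounded_linear f" "f \<noteq> (\<lambda>_. 0)" "\<And>y. y \<in> S \<Longrightarrow> f y = 0"
proof -
  obtain x where x: "x \<notin> closure (span S)" using assms by (auto simp: linearly_dense_def)
  obtain f where f: "bounded_linear f" "\<And>y. y \<in> span S \<Longrightarrow> f y = 0" "f x = infdist x (span S)"
    using Hahn_Banach_infdist[OF subspace_span] by metis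
  have "span S \<noteq> {}" using span_0 by blast
  then have "f x \<noteq> 0" using x f(3) in_closure_iff_infdist_zero by metis
  then show ?thesis using that[of f] f(1,2) span_base by metis
qed

lemma linearly_dense_ext:
  fixes f g :: "'a::real_normed_vector \<Rightarrow> real"
  assumes S: "linearly_dense S" and f: "bounded_linear f" and g: "bounded_linear g"
    and eq: "\<And>y. y \<in> S \<Longrightarrow> f y = g y"
  shows "f = g"
proof
  fix x
  have "f y = g y" if "y \<in> span S" for y
    using linear_eq_on_span[of f g S] f g eq that by (simp add: bounded_linear.linear)
  then have "span S \<subseteq> {y. f y = g y}" by blast
  moreover have "closed {y. f y = g y}"
    using f g by (intro closed_Collect_eq linear_continuous_on)
  ultimately have "closure (span S) \<subseteq> {y. f y = g y}" by (rule closure_minimal)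
  then show "f x = g x" using S by (auto simp: linearly_dense_def)
qed

section \<open>The weak topology\<close>

lemma topspace_weak_topology [simp]: "topspace weak_topology = (UNIV :: 'a::real_normed_vector set)"
proof -
  \<comment> \<open>The zero functional puts the whole space into the generating family.\<close>
  have "UNIV \<in> {f -` U | (f :: 'a \<Rightarrow> real) U. bounded_linear f \<and> open U}"
    using bounded_linear_zero open_UNIV by (intro CollectI exI[of _ "\<lambda>_. 0"] exI[of _ UNIV]) auto
  then show ?thesis unfolding weak_topology_def topology_generated_by_topspace by blast
qed

lemma continuous_map_weak_topology_functional:
  fixes f :: "'a::real_normed_vector \<Rightarrow> real"
  assumes "bounded_linear f"
  shows "continuous_map weak_topology euclideanreal f"
  unfolding continuous_map_def
proof (intro conjI allI impI)
  fix U assume "openin euclideanreal U"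
  then have "f -` U \<in> {f -` U | (f :: 'a \<Rightarrow> real) U. bounded_linear f \<and> open U}"
    using assms by auto
  then show "openin weak_topology {x \<in> topspace weak_topology. f x \<in> U}"
    unfolding weak_topology_def[symmetric] topspace_weak_topology
    by (simp add: weak_topology_def topology_generated_by_Basis vimage_def)
qed auto

lemma continuous_map_into_weak_topology:
  fixes g :: "'b \<Rightarrow> 'a::real_normed_vector"
  assumes "\<And>f :: 'a \<Rightarrow> real. bounded_linear f \<Longrightarrow> continuous_map X euclideanreal (\<lambda>x. f (g x))"
  shows "continuous_map X weak_topology g"
  unfolding weak_topology_def
proof (rule continuous_on_generated_topo)
  fix V assume "V \<in> {f -` U | (f :: 'a \<Rightarrow> real) U. bounded_linear f \<and> open U}"
  then obtain f :: "'a \<Rightarrow> real" and U where f: "bounded_linear f" and U: "open U" and V: "V = f -` U"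
    by blast
  have "openin X {x \<in> topspace X. f (g x) \<in> U}"
    using assms[OF f] U by (auto simp: continuous_map_def)
  moreover have "g -` V \<inter> topspace X = {x \<in> topspace X. f (g x) \<in> U}" using V by auto
  ultimately show "openin X (g -` V \<inter> topspace X)" by simp
next
  show "g ` topspace X \<subseteq> \<Union> {f -` U | (f :: 'a \<Rightarrow> real) U. bounded_linear f \<and> open U}"
    using topspace_weak_topology[where 'a='a]
    unfolding weak_topology_def topology_generated_by_topspace by simp
qed

text \<open>A norming functional for \<open>- z\<close> works. The sign is chosen so that
  \<open>z = x - y\<close> gives \<open>f x < f y\<close>.\<close>

lemma ex_functional_neg:
  fixes z :: "'a::real_normed_vector"
  assumes "z \<noteq> 0"
  obtains f :: "'a \<Rightarrow> real" where "bounded_linear f" "f z < 0"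
proof -
  obtain f where f: "bounded_linear f" "f (- z) = norm (- z)"
    using Hahn_Banach_norm by metis
  have "- f z = norm z" using f linear_neg[of f z] by (simp add: bounded_linear.linear)
  moreover have "norm z > 0" using assms by simp
  ultimately have "f z < 0" by linarith
  then show ?thesis using that f(1) by blast
qed

lemma Hausdorff_weak_topology: "Hausdorff_space (weak_topology :: 'a::real_normed_vector topology)"
  unfolding Hausdorff_space_def
proof (intro allI impI)
  fix x y :: 'a
  assume xy: "x \<in> topspace weak_topology \<and> y \<in> topspace weak_topology \<and> x \<noteq> y"
  then obtain f :: "'a \<Rightarrow> real" where f: "bounded_linear f" "f (x - y) < 0"
    using ex_functional_neg[of "x - y"] by auto
  then have lt: "f x < f y" by (simp add: linear_diff bounded_linear.linear)
  have opn: "openin weak_topology {z. f z \<in> V}" if "open V" for V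
    using continuous_map_weak_topology_functional[OF f(1)] that by (auto simp: continuous_map_def)
  define m where "m = (f x + f y) / 2"
  have "openin weak_topology {z. f z \<in> {..<m}}" "openin weak_topology {z. f z \<in> {m<..}}"
    by (intro opn; simp)+
  moreover have "f x < m" "m < f y" using lt by (auto simp: m_def)
  moreover have "disjnt {z. f z \<in> {..<m}} {z. f z \<in> {m<..}}" by (auto simp: disjnt_iff)
  ultimately show "\<exists>U V. openin weak_topology U \<and> openin weak_topology V \<and> x \<in> U \<and> y \<in> V \<and> disjnt U V"
    by (metis mem_Collect_eq lessThan_iff greaterThan_iff)
qed

text \<open>The weak topology is Hausdorff, so \<open>W\<close> is weakly closed and contains the
  weak closure of \<open>S\<close>.\<close>

lemma rel_weakly_compact_subset:
  assumes "compactin weak_topology W" "S \<subseteq> W"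
  shows "rel_weakly_compact S"
  unfolding rel_weakly_compact_def
proof (rule closed_compactin[OF assms(1)])
  have "closedin weak_topology W"
    using compactin_imp_closedin[OF Hausdorff_weak_topology assms(1)] .
  then show "weak_topology closure_of S \<subseteq> W" using assms(2) by (intro closure_of_minimal)
qed (rule closedin_closure_of)

section \<open>Boundedness of weakly compact sets\<close>

lemma weakly_compact_functional_bounded:
  fixes f :: "'a::real_normed_vector \<Rightarrow> real"
  assumes "compactin weak_topology K" "bounded_linear f"
  obtains B where "\<And>x. x \<in> K \<Longrightarrow> \<bar>f x\<bar> \<le> B"
proof -
  have "compactin euclideanreal (f ` K)"
    using image_compactin assms continuous_map_weak_topology_functional by blast
  then have "bounded (f ` K)" by (simp add: compact_imp_bounded)
  then show ?thesis using that by (auto simp: bounded_iff)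
qed

text \<open>The uniform boundedness principle, via Baire's theorem in the dual space.\<close>
lemma weakly_compact_norm_bounded:
  fixes K :: "'a::real_normed_vector set"
  assumes K: "compactin weak_topology K"
  obtains B where "B \<ge> 0" "\<And>x. x \<in> K \<Longrightarrow> norm x \<le> B"
proof -
  define E where "E n = {f :: 'a \<Rightarrow>\<^sub>L real. \<forall>x\<in>K. \<bar>blinfun_apply f x\<bar> \<le> real n}" for n :: nat
  have closed: "closed (E n)" for n
  proof -
    have "closed {f :: 'a \<Rightarrow>\<^sub>L real. \<bar>blinfun_apply f x\<bar> \<le> real n}" for x
      by (intro closed_Collect_le continuous_intros)
    then have "closed (\<Inter>x\<in>K. {f :: 'a \<Rightarrow>\<^sub>L real. \<bar>blinfun_apply f x\<bar> \<le> real n})" by blast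
    moreover have "E n = (\<Inter>x\<in>K. {f. \<bar>blinfun_apply f x\<bar> \<le> real n})" by (auto simp: E_def)
    ultimately show ?thesis by simp
  qed
  have cover: "(\<Union>n. E n) = UNIV"
  proof -
    have "\<exists>n. f \<in> E n" for f
    proof -
      obtain B where B: "\<And>x. x \<in> K \<Longrightarrow> \<bar>blinfun_apply f x\<bar> \<le> B"
        using weakly_compact_functional_bounded[OF K blinfun.bounded_linear_right, of f] by metis
      obtain n where "B \<le> real n" using real_arch_simple by blast
      then have "f \<in> E n" using B by (auto simp: E_def intro: order_trans)
      then show ?thesis ..
    qed
    then show ?thesis by blast
  qed
  have "\<exists>n. interior (E n) \<noteq> {}"
  proof (rule ccontr)
    assume "\<not> ?thesis"
    then have "Met_TC.mtopology interior_of \<Union>(range E) = {}"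
      using closed complete_UNIV by (intro Met_TC.metric_Baire_category_alt) (auto simp: mcomplete_iff_complete)
    then show False using cover by (simp)
  qed
  then obtain n f r where r: "r > 0" and ball: "cball f r \<subseteq> E n"
    by (metis all_not_in_conv mem_interior_cball)
  have "norm x \<le> 2 * real n / r" if x: "x \<in> K" for x
  proof -
    obtain g0 where g0: "bounded_linear g0" "\<And>y. \<bar>g0 y\<bar> \<le> norm y" "g0 x = norm x"
      using Hahn_Banach_norm[of x] by metis
    define g where "g = Blinfun g0"
    have g: "blinfun_apply g = g0" using g0(1) by (simp add: g_def bounded_linear_Blinfun_apply)
    have "norm g \<le> 1" using g0(2) by (intro norm_blinfun_bound) (auto simp: g)
    \<comment> \<open>Both \<open>f\<close> and \<open>f + r *\<^sub>R g\<close> lie in the ball, so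
      both are at most \<open>n\<close> in absolute value at \<open>x\<close>; they differ there by
      \<open>r * norm x\<close>.\<close>
    then have "f + r *\<^sub>R g \<in> cball f r" using r by (simp add: dist_norm mult_left_le)
    then have "\<bar>f x + r * norm x\<bar> \<le> real n" using ball x g0(3)
      by (force simp: E_def g blinfun.add_left blinfun.scaleR_left)
    moreover have "\<bar>f x\<bar> \<le> real n" using ball x r by (force simp: E_def)
    ultimately have "r * norm x \<le> 2 * real n" by linarith
    then show ?thesis using r by (simp add: field_simps)
  qed
  then show ?thesis using r by (intro that[of "2 * real n / r"]) auto
qed

section \<open>Weakly compact sets of power combinations\<close>

text \<open>The exponent \<open>Suc n\<close> leaves the constant coefficient free to hold a
  prescribed value. The argument is a pair, so that the sums form the image of a product
  space.\<close>

definition power_combination :: "real \<times> (nat \<Rightarrow> 'a) \<Rightarrow> 'a::real_normed_vector" where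
  "power_combination p = (\<Sum>n. fst p ^ Suc n *\<^sub>R snd p n)"

definition power_combinations :: "'a set \<Rightarrow> 'a::real_normed_vector set" where
  "power_combinations K = power_combination ` ({0..1/2} \<times> (UNIV \<rightarrow> K))"

lemma power_combination_sums:
  fixes k :: "nat \<Rightarrow> 'a::banach"
  assumes "\<bar>t\<bar> < 1" "\<And>n. norm (k n) \<le> B"
  shows "(\<lambda>n. t ^ Suc n *\<^sub>R k n) sums power_combination (t, k)"
proof -
  have "summable (\<lambda>n. t ^ Suc n *\<^sub>R k n)"
  proof (rule summable_comparison_test')
    show "summable (\<lambda>n. B * \<bar>t\<bar> ^ Suc n)"
      using assms(1) by (intro summable_mult) (simp add: summable_mult summable_geometric)
    show "norm (t ^ Suc n *\<^sub>R k n) \<le> B * \<bar>t\<bar> ^ Suc n" for n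
      using mult_left_mono[OF assms(2), of "\<bar>t\<bar> ^ Suc n" n] by (simp add: power_abs mult_ac abs_mult)
  qed
  then show ?thesis by (simp add: power_combination_def summable_sums)
qed

lemma functional_power_combination_sums:
  fixes k :: "nat \<Rightarrow> 'a::banach" and f :: "'a \<Rightarrow> real"
  assumes "\<bar>t\<bar> < 1" "\<And>n. norm (k n) \<le> B" "bounded_linear f"
  shows "(\<lambda>n. t ^ Suc n * f (k n)) sums f (power_combination (t, k))"
  using bounded_linear.sums[OF assms(3) power_combination_sums[OF assms(1,2)]]
    linear_scale[OF bounded_linear.linear[OF assms(3)]] by simp

text \<open>By Tychonoff's theorem the parameter space is compact. The sum depends weakly
  continuously on the parameters, since each functional of it is a uniform limit of continuous
  partial sums.\<close>

lemma weakly_compact_power_combinations: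
  fixes K :: "'a::banach set"
  assumes K: "compactin weak_topology K"
  shows "compactin weak_topology (power_combinations K)"
proof -
  obtain B where B: "B \<ge> 0" "\<And>x. x \<in> K \<Longrightarrow> norm x \<le> B"
    using weakly_compact_norm_bounded[OF K] by blast
  define T where "T = top_of_set {0..1/2::real}"
  define P where "P = product_topology (\<lambda>_::nat. subtopology weak_topology K) UNIV"
  have topP: "topspace (prod_topology T P) = {0..1/2} \<times> (UNIV \<rightarrow> K)"
    by (simp add: T_def P_def PiE_UNIV_domain)
  have "compact_space T" "compact_space P"
    using K by (auto simp: T_def P_def compact_space_subtopology compact_space_product_topology)
  then have comp: "compactin (prod_topology T P) ({0..1/2} \<times> (UNIV \<rightarrow> K))"
    using compact_space_prod_topology topP unfolding compact_space_def by metis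
  have "continuous_map (prod_topology T P) weak_topology power_combination"
  proof (rule continuous_map_into_weak_topology)
    fix f :: "'a \<Rightarrow> real" assume f: "bounded_linear f"
    obtain C where C: "\<And>x. x \<in> K \<Longrightarrow> \<bar>f x\<bar> \<le> C" 
      using weakly_compact_functional_bounded[OF K f] by metis
    define part where "part N p = (\<Sum>n<N. fst p ^ Suc n * f (snd p n))" for N p
    show "continuous_map (prod_topology T P) euclideanreal (\<lambda>p. f (power_combination p))"
      unfolding mtopology_is_euclidean[symmetric]
    proof (rule Met_TC.continuous_map_uniform_limit[where f = part and F = sequentially])
      have fst: "continuous_map (prod_topology T P) euclideanreal fst"
        using continuous_map_fst continuous_map_into_fulltopology unfolding T_def by blast
      have snd: "continuous_map (prod_topology T P) euclideanreal (\<lambda>p. f (snd p n))" for n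
      proof -
        have "continuous_map (prod_topology T P) (subtopology weak_topology K) (\<lambda>p. snd p n)"
          unfolding P_def
          using continuous_map_compose[OF continuous_map_snd continuous_map_product_projection[of n UNIV]]
          by (simp add: o_def)
        then have "continuous_map (prod_topology T P) weak_topology (\<lambda>p. snd p n)"
          by (rule continuous_map_into_fulltopology)
        from continuous_map_compose[OF this continuous_map_weak_topology_functional[OF f]]
        show ?thesis by (simp add: o_def)
      qed
      show "\<forall>\<^sub>F N in sequentially. continuous_map (prod_topology T P) Met_TC.mtopology (part N)"
        unfolding part_def mtopology_is_euclidean
        by (intro always_eventually allI continuous_map_sum continuous_map_real_mult
            continuous_map_real_pow fst snd) auto
    next
      fix \<epsilon> :: real assume "\<epsilon> > 0"
      \<comment> \<open>As \<open>t \<le> 1/2\<close>, this geometric series majorizes the tails at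
        every point \<open>p\<close> simultaneously.\<close>
      have "summable (\<lambda>n. C * (1/2) ^ Suc n)" by (intro summable_mult) (simp add: summable_geometric)
      from suminf_exist_split[OF \<open>\<epsilon> > 0\<close> this]
      obtain N0 where N0: "\<And>N. N \<ge> N0 \<Longrightarrow> norm (\<Sum>i. C * (1/2) ^ Suc (i + N)) < \<epsilon>"
        by blast
      show "\<forall>\<^sub>F N in sequentially. \<forall>p\<in>topspace (prod_topology T P). f (power_combination p) \<in> UNIV
          \<and> dist (part N p) (f (power_combination p)) < \<epsilon>"
      proof (rule eventually_sequentiallyI[of N0], intro ballI conjI UNIV_I)
        fix N p assume "N0 \<le> N" and "p \<in> topspace (prod_topology T P)"
        then obtain t k where p: "p = (t, k)" and t: "0 \<le> t" "t \<le> 1/2" and k: "\<And>n. k n \<in> K"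
          unfolding topP by (auto simp: Pi_iff)
        have sums: "(\<lambda>n. t ^ Suc n * f (k n)) sums f (power_combination p)"
          unfolding p using t k B f by (intro functional_power_combination_sums) auto
        have geo: "summable (\<lambda>i. C * (1/2) ^ Suc (i + N))"
          using summable_ignore_initial_segment[OF \<open>summable (\<lambda>n. C * (1/2) ^ Suc n)\<close>, of N] by simp
        have "f (power_combination p) - part N p = (\<Sum>i. t ^ Suc (i + N) * f (k (i + N)))"
          using suminf_minus_initial_segment[OF sums_summable[OF sums], of N] sums_unique[OF sums]
          by (simp add: part_def p)
        also have "norm \<dots> \<le> (\<Sum>i. C * (1/2) ^ Suc (i + N))"
        proof (rule norm_suminf_le[OF _ geo])
          fix i
          have "t ^ Suc (i + N) \<le> (1/2) ^ Suc (i + N)" using t by (intro power_mono)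
          then have "t ^ Suc (i + N) * \<bar>f (k (i + N))\<bar> \<le> (1/2) ^ Suc (i + N) * C"
            using t k C by (intro mult_mono) auto
          then show "norm (t ^ Suc (i + N) * f (k (i + N))) \<le> C * (1/2) ^ Suc (i + N)"
            using t by (simp add: abs_mult mult_ac)
        qed
        finally show "dist (part N p) (f (power_combination p)) < \<epsilon>"
          using N0[OF \<open>N0 \<le> N\<close>] by (simp add: dist_norm norm_minus_commute)
      qed
    qed simp
  qed
  from image_compactin[OF comp this] show ?thesis by (simp add: power_combinations_def)
qed

text \<open>Bounded coefficients make the complexified series \<open>F\<close> holomorphic on the
  unit disc. As \<open>a m \<noteq> 0\<close>, it is not identically zero, so the identity theorem
  leaves finitely many zeros in the closed disc of radius 1/2.\<close>

lemma finite_zeros_power_series: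
  fixes a :: "nat \<Rightarrow> real"
  assumes bound: "\<And>n. \<bar>a n\<bar> \<le> B" and m: "a m \<noteq> 0"
  shows "finite {t. \<bar>t\<bar> \<le> 1/2 \<and> (\<Sum>n. a n * t ^ n) = 0}"
proof -
  define F where "F z = (\<Sum>n. complex_of_real (a n) * z ^ n)" for z
  have summ: "summable (\<lambda>n. complex_of_real (a n) * z ^ n)" if "norm z < 1" for z
  proof (rule summable_comparison_test')
    show "summable (\<lambda>n. B * norm z ^ n)" using that by (intro summable_mult) simp
    show "norm (complex_of_real (a n) * z ^ n) \<le> B * norm z ^ n" for n
      using mult_right_mono[OF bound, of "norm z ^ n" n] by (simp add: norm_mult norm_power)
  qed
  have sums: "(\<lambda>n. complex_of_real (a n) * (z - 0) ^ n) sums F z" if "z \<in> ball 0 1" for z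
    using summ[of z] that by (simp add: F_def summable_sums)
  have hol: "F holomorphic_on ball 0 1" by (rule power_series_holomorphic[OF sums])
  have "\<exists>z\<in>ball 0 1. F z \<noteq> 0"
  proof (cases "a 0 = 0")
    case False
    have "F 0 = complex_of_real (a 0)" unfolding F_def by simp
    then show ?thesis using False by (intro bexI[of _ 0]) auto
  next
    case True
    then have F0: "F 0 = 0" unfolding F_def by simp
    have "m > 0" using True m by (cases m) auto
    obtain s where s: "0 < s" "\<And>z. z \<in> cball 0 s - {0} \<Longrightarrow> F z \<noteq> 0"
      using powser_0_nonzero[of 1 0 "\<lambda>n. complex_of_real (a n)" F m] sums F0 m \<open>m > 0\<close> by auto
    \<comment> \<open>The minimum keeps \<open>z\<close> both in the punctured disc without zeros
      and in the unit disc.\<close>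
    define z where "z = complex_of_real (min s (1/2))"
    have "norm z = min s (1/2)" using s(1) by (simp add: z_def)
    then have "z \<in> cball 0 s - {0}" "z \<in> ball 0 1" using s(1) by auto
    then show ?thesis using s(2) by blast
  qed
  then have "finite {z \<in> cball 0 (1/2). F z = 0}"
  \<comment> \<open>The identity theorem is applied to nonconstant \<open>F\<close>; a constant
    \<open>F\<close> is a nonzero constant and has no zeros.\<close>
  proof (cases "F constant_on ball 0 1")
    case False
    moreover have "cball 0 (1/2) \<subseteq> ball (0 :: complex) 1" by auto
    ultimately show ?thesis
      using holomorphic_compact_finite_zeros[OF hol open_ball connected_ball compact_cball] by blast
  next
    case True
    with \<open>\<exists>z\<in>ball 0 1. F z \<noteq> 0\<close> have "F z \<noteq> 0" if "z \<in> ball 0 1" for z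
      using that unfolding constant_on_def by metis
    then have "{z \<in> cball 0 (1/2). F z = 0} \<subseteq> {}" by auto
    then show ?thesis using finite_subset by blast
  qed
  moreover have "complex_of_real ` {t. \<bar>t\<bar> \<le> 1/2 \<and> (\<Sum>n. a n * t ^ n) = 0} \<subseteq> {z \<in> cball 0 (1/2). F z = 0}"
  proof (rule image_subsetI)
    fix t :: real assume "t \<in> {t. \<bar>t\<bar> \<le> 1/2 \<and> (\<Sum>n. a n * t ^ n) = 0}"
    then have t: "\<bar>t\<bar> \<le> 1/2" "(\<Sum>n. a n * t ^ n) = 0" by auto
    have "norm (complex_of_real t) < 1" using t(1) by simp
    from summ[OF this] have "summable (\<lambda>n. complex_of_real (a n * t ^ n))" by simp
    then have "summable (\<lambda>n. a n * t ^ n)" by (simp only: summable_complex_of_real)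
    from suminf_of_real[OF this, where 'a=complex] have "F (complex_of_real t) = 0"
      using t(2) by (simp add: F_def)
    then show "complex_of_real t \<in> {z \<in> cball 0 (1/2). F z = 0}" using t(1) by simp
  qed
  ultimately have "finite (complex_of_real ` {t. \<bar>t\<bar> \<le> 1/2 \<and> (\<Sum>n. a n * t ^ n) = 0})"
    by (rule finite_subset[rotated])
  then show ?thesis by (rule finite_imageD) (simp add: inj_on_def)
qed

text \<open>Pairs serve two purposes: \<open>c = 0\<close> demands that \<open>f\<close> not vanish
  at the new point, and \<open>c = f y\<close> demands that the new point differ from
  \<open>y\<close>.\<close>

lemma power_combinations_avoid_countable:
  fixes K :: "'a::banach set" and F :: "(('a \<Rightarrow> real) \<times> real) set"
  assumes K: "compactin weak_topology K" "linearly_dense K" and F: "countable F" "F \<noteq> {}"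
    and func: "\<And>f c. (f, c) \<in> F \<Longrightarrow> bounded_linear f \<and> f \<noteq> (\<lambda>_. 0)"
  obtains s where "s \<in> power_combinations K" "\<And>f c. (f, c) \<in> F \<Longrightarrow> f s \<noteq> c"
proof -
  obtain B where B: "B \<ge> 0" "\<And>x. x \<in> K \<Longrightarrow> norm x \<le> B"
    using weakly_compact_norm_bounded[OF K(1)] by blast
  define e where "e = from_nat_into F"
  have e: "e n \<in> F" for n using F(2) by (simp add: e_def from_nat_into)
  have "\<exists>x\<in>K. fst (e n) x \<noteq> 0" for n
  proof (rule ccontr)
    assume "\<not> ?thesis"
    then have "fst (e n) = (\<lambda>_. 0)"
      using func[of "fst (e n)" "snd (e n)"] e[of n]
      by (intro linearly_dense_ext[OF K(2)]) (auto simp: bounded_linear_zero)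
    then show False using func[of "fst (e n)" "snd (e n)"] e[of n] by simp
  qed
  then obtain k where k: "\<And>n. k n \<in> K" "\<And>n. fst (e n) (k n) \<noteq> 0" by metis
  \<comment> \<open>These are the coefficients in \<open>t\<close> of the \<open>m\<close>-th
    functional minus its forbidden value. The coefficient of index \<open>Suc m\<close> is nonzero
    by the choice of \<open>k m\<close>.\<close>
  define a where "a m n = (case n of 0 \<Rightarrow> - snd (e m) | Suc i \<Rightarrow> fst (e m) (k i))" for m n
  have lin: "bounded_linear (fst (e m))" for m
    using func[of "fst (e m)" "snd (e m)"] e[of m] by simp
  have series: "(\<Sum>n. a m n * t ^ n) = fst (e m) (power_combination (t, k)) - snd (e m)"
    if "\<bar>t\<bar> < 1" for m t
  proof -
    have "(\<lambda>n. a m (Suc n) * t ^ Suc n) sums fst (e m) (power_combination (t, k))"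
      using functional_power_combination_sums[of t k B "fst (e m)"] that k B lin
      by (simp add: a_def mult.commute)
    from sums_Suc[OF this] have "(\<lambda>n. a m n * t ^ n) sums (fst (e m) (power_combination (t, k)) - snd (e m))"
      by (simp add: a_def)
    then show ?thesis by (simp add: sums_iff)
  qed
  have "finite {t. \<bar>t\<bar> \<le> 1/2 \<and> (\<Sum>n. a m n * t ^ n) = 0}" for m
  proof -
    obtain C where C: "\<And>x. x \<in> K \<Longrightarrow> \<bar>fst (e m) x\<bar> \<le> C"
      using weakly_compact_functional_bounded[OF K(1) lin[of m]] by metis
    show ?thesis
    proof (rule finite_zeros_power_series[where B = "max C \<bar>snd (e m)\<bar>" and m = "Suc m"])
      show "\<bar>a m n\<bar> \<le> max C \<bar>snd (e m)\<bar>" for n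
        using C[OF k(1)] by (cases n) (auto simp: a_def le_max_iff_disj)
      show "a m (Suc m) \<noteq> 0" using k(2) by (simp add: a_def)
    qed
  qed
  then have "countable (\<Union>m. {t. \<bar>t\<bar> \<le> 1/2 \<and> (\<Sum>n. a m n * t ^ n) = 0})" by (simp add: countable_finite)
  from real_interval_avoid_countable_set[OF _ this, of 0 "1/2"]
  obtain t where "t \<in> {0<..<1/2}"
    "t \<notin> (\<Union>m. {t. \<bar>t\<bar> \<le> 1/2 \<and> (\<Sum>n. a m n * t ^ n) = 0})"
    by auto
  then have t: "0 < t" "t < 1/2" "(\<Sum>n. a m n * t ^ n) \<noteq> 0" for m
    by simp_all
  show ?thesis
  proof
    show "power_combination (t, k) \<in> power_combinations K"
      unfolding power_combinations_def using t k by (intro imageI) auto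
    fix f c assume "(f, c) \<in> F"
    then obtain m where m: "e m = (f, c)" using from_nat_into_surj[OF F(1)] unfolding e_def by metis
    show "f (power_combination (t, k)) \<noteq> c" using t series[of t m] m by auto
  qed
qed

section \<open>Cardinality of the dual space\<close>

text \<open>A real codes a set of naturals, which \<open>prod_encode\<close> slices into a sequence
  of such sets, hence into a sequence of reals.\<close>

lemma surj_real_sequences:
  assumes "\<exists>g :: real \<Rightarrow> 'b. surj g"
  shows "\<exists>g :: real \<Rightarrow> (nat \<Rightarrow> 'b). surj g"
proof -
  obtain g :: "real \<Rightarrow> 'b" where g: "surj g" using assms by blast
  obtain c :: "nat set \<Rightarrow> real" where c: "bij c"
    using nat_sets_eqpoll_reals unfolding eqpoll_def by blast
  define d where "d r n = g (c {m. prod_encode (n, m) \<in> inv c r})" for r n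
  have "\<exists>r. h = d r" for h
  proof -
    define a where "a n = inv c (inv g (h n))" for n
    define A where "A = {k. snd (prod_decode k) \<in> a (fst (prod_decode k))}"
    have "d (c A) n = h n" for n
    proof -
      have "d (c A) n = g (c (a n))" using c by (simp add: d_def A_def bij_is_inj)
      also have "\<dots> = h n" using c g by (simp add: a_def bij_is_surj surj_f_inv_f)
      finally show ?thesis .
    qed
    then have "h = d (c A)" by auto
    then show ?thesis by blast
  qed
  then have "surj d" unfolding surj_def by blast
  then show ?thesis by blast
qed

lemma surj_real_Times:
  assumes "\<exists>g :: real \<Rightarrow> 'b. surj g"
  shows "\<exists>g :: real \<Rightarrow> 'b \<times> real. surj g"
proof -
  obtain g :: "real \<Rightarrow> 'b" where g: "surj g" using assms by blast
  obtain e :: "real \<Rightarrow> (nat \<Rightarrow> real)" where e: "surj e"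
    using surj_real_sequences[of] surj_id by blast
  have "\<exists>r. p = (g (e r 0), e r 1)" for p
  proof -
    obtain r where "e r = (\<lambda>n. if n = 0 then inv g (fst p) else snd p)"
      using e by (metis surjD)
    then show ?thesis using g by (intro exI[of _ r]) (simp add: surj_f_inv_f)
  qed
  then have "surj (\<lambda>r. (g (e r 0), e r 1))" unfolding surj_def by blast
  then show ?thesis by blast
qed

text \<open>Each point is the limit of a sequence in \<open>D\<close>, and reals code these
  sequences. Codes of divergent sequences get an arbitrary value from \<open>lim\<close>, harmless
  for surjectivity.\<close>

lemma surj_real_if_dense:
  fixes D :: "'a::metric_space set"
  assumes D: "closure D = UNIV" and g: "D \<subseteq> range (g :: real \<Rightarrow> 'a)"
  shows "\<exists>g :: real \<Rightarrow> 'a. surj g"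
proof -
  obtain e :: "real \<Rightarrow> (nat \<Rightarrow> real)" where e: "surj e"
    using surj_real_sequences[of] surj_id by blast
  have "\<exists>r. x = lim (\<lambda>n. g (e r n))" for x
  proof -
    obtain s where s: "\<And>n. s n \<in> D" "s \<longlonglongrightarrow> x" using D closure_sequential by blast
    have "\<forall>n. \<exists>r. s n = g r" using s(1) g by blast
    then obtain h where h: "\<And>n. s n = g (h n)" by metis
    obtain r where "e r = h" using e by (metis surjD)
    then have "(\<lambda>n. g (e r n)) = s" using h by auto
    then show ?thesis using s(2) limI by metis
  qed
  then have "surj (\<lambda>r. lim (\<lambda>n. g (e r n)))" unfolding surj_def by blast
  then show ?thesis by blast
qed

text \<open>The data \<open>h\<close> form a double sequence, so they are no more than continuum
  many when \<open>'b\<close> is an image of the reals. Finite unions and intersections enter as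
  enumerations with repetitions.\<close>

definition halfspace_combination :: "('b \<Rightarrow> 'a \<Rightarrow> real) \<Rightarrow> (nat \<Rightarrow> nat \<Rightarrow> 'b \<times> real) \<Rightarrow> 'a set" where
  "halfspace_combination G h = (\<Union>n. \<Inter>m. {x. G (fst (h n m)) x < snd (h n m)})"

lemma compactin_cover_index:
  assumes "compactin T A" "\<And>i. i \<in> I \<Longrightarrow> openin T (U i)" "A \<subseteq> (\<Union>i\<in>I. U i)"
  obtains J where "finite J" "J \<subseteq> I" "A \<subseteq> (\<Union>i\<in>J. U i)"
proof -
  obtain \<F> where "finite \<F>" "\<F> \<subseteq> U ` I" "A \<subseteq> \<Union>\<F>"
    using assms unfolding compactin_def by (metis imageE)
  then show ?thesis using that finite_subset_image[of \<F> U I] by auto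
qed

text \<open>The zero functional makes \<open>{}\<close> and the whole space available as half-spaces, which covers the
  degenerate cases.\<close>
lemma separate_compact_by_halfspaces:
  assumes A: "compactin T A" and C: "compactin T C"
    and G: "\<And>z. continuous_map T euclideanreal (G z)"
    and sep: "\<And>x y. x \<in> A \<Longrightarrow> y \<in> C \<Longrightarrow> \<exists>z. G z x < G z y"
    and zero: "G z0 = (\<lambda>_. 0)"
  obtains h where "A \<subseteq> halfspace_combination G h" "C \<inter> halfspace_combination G h = {}"
proof -
  have less: "openin T {x \<in> topspace T. G z x < q}" for z q
    using openin_continuous_map_preimage[OF G[of z], of "{..<q}"] by simp
  have greater: "openin T {x \<in> topspace T. q < G z x}" for z q
    using openin_continuous_map_preimage[OF G[of z], of "{q<..}"] by simp
  have AT: "A \<subseteq> topspace T" and CT: "C \<subseteq> topspace T"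
    using A C compactin_subset_topspace by auto
  \<comment> \<open>Around each \<open>x\<close> in \<open>A\<close>, compactness of
    \<open>C\<close> gives finitely many half-spaces containing \<open>x\<close> such that every
    point of \<open>C\<close> lies outside one of them.\<close>
  have "\<exists>F. finite F \<and> F \<noteq> {} \<and> (\<forall>i\<in>F. G (fst i) x < snd i) \<and> (\<forall>y\<in>C. \<exists>i\<in>F. snd i < G (fst i) y)"
    if x: "x \<in> A" for x
  proof -
    define I where "I = {i. G (fst i) x < snd i}"
    have "C \<subseteq> (\<Union>i\<in>I. {y \<in> topspace T. snd i < G (fst i) y})"
    proof
      fix y assume y: "y \<in> C"
      then obtain z where "G z x < G z y" using sep x by blast
      then obtain q where "G z x < q" "q < G z y" using dense by blast
      then show "y \<in> (\<Union>i\<in>I. {y \<in> topspace T. snd i < G (fst i) y})"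
        using y CT by (intro UN_I[of "(z, q)"]) (auto simp: I_def)
    qed
    from compactin_cover_index[OF C greater this]
    obtain J where J: "finite J" "J \<subseteq> I" "C \<subseteq> (\<Union>i\<in>J. {y \<in> topspace T. snd i < G (fst i) y})"
      by blast
    have "\<forall>i\<in>insert (z0, 1) J. G (fst i) x < snd i" using J(2) zero by (auto simp: I_def)
    moreover have "\<forall>y\<in>C. \<exists>i\<in>insert (z0, 1) J. snd i < G (fst i) y" using J(3) by blast
    ultimately show ?thesis using J(1) by blast
  qed
  then obtain F where F: "\<And>x. x \<in> A \<Longrightarrow> finite (F x)" "\<And>x. x \<in> A \<Longrightarrow> F x \<noteq> {}"
    "\<And>x i. x \<in> A \<Longrightarrow> i \<in> F x \<Longrightarrow> G (fst i) x < snd i"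
    "\<And>x y. x \<in> A \<Longrightarrow> y \<in> C \<Longrightarrow> \<exists>i\<in>F x. snd i < G (fst i) y"
    by metis
  define U where "U x = (\<Inter>i\<in>F x. {u \<in> topspace T. G (fst i) u < snd i})" for x
  have U: "openin T (U x)" if "x \<in> A" for x
    unfolding U_def using F(1,2) that less by (intro openin_INT2) auto
  have "x \<in> U x" if "x \<in> A" for x
    using F(3)[OF that] AT that by (auto simp: U_def)
  then have "A \<subseteq> (\<Union>x\<in>A. U x)" by blast
  from compactin_cover_index[OF A U this]
  obtain J where J: "finite J" "J \<subseteq> A" "A \<subseteq> (\<Union>x\<in>J. U x)" by blast
  show ?thesis
  proof (cases "J = {}")
    case True
    have "halfspace_combination G (\<lambda>_ _. (z0, 0)) = {}"
      by (simp add: halfspace_combination_def zero)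
    then show ?thesis using that[of "\<lambda>_ _. (z0, 0)"] J(3) True by simp
  next
    case False
    define e where "e = from_nat_into J"
    have range_e: "range e = J" using False J(1) by (simp add: e_def range_from_nat_into countable_finite)
    define h where "h n = from_nat_into (F (e n))" for n
    have range_h: "range (h n) = F (e n)" for n
    proof -
      have "e n \<in> A" using range_e J(2) by blast
      then show ?thesis using F(1,2) by (simp add: h_def range_from_nat_into countable_finite)
    qed
    have eq: "halfspace_combination G h = (\<Union>x\<in>J. \<Inter>i\<in>F x. {u. G (fst i) u < snd i})"
      unfolding halfspace_combination_def range_e[symmetric] by (simp add: range_h[symmetric])
    have "(\<Union>x\<in>J. U x) \<subseteq> halfspace_combination G h"
      unfolding eq U_def by (intro UN_mono INT_anti_mono order_refl) auto
    with J(3) have "A \<subseteq> halfspace_combination G h" by (rule order_trans)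
    moreover have "C \<inter> halfspace_combination G h = {}"
    proof -
      have False if "y \<in> C" "x \<in> J" "\<forall>i\<in>F x. G (fst i) y < snd i" for x y
        using F(4)[of x y] that J(2) by (meson less_asym subsetD)
      then show ?thesis unfolding eq by (auto simp: disjoint_iff)
    qed
    ultimately show ?thesis by (rule that)
  qed
qed

text \<open>A functional is determined by its restriction to \<open>K\<close>, and the restriction by the countably
  many sets separating \<open>{x \<in> K. a \<le> f x}\<close> from \<open>{x \<in> K. f x \<le> b}\<close> for rationals \<open>b < a\<close>.\<close>
lemma dual_le_continuum:
  fixes K :: "'a::banach set"
  assumes K: "compactin weak_topology K" "linearly_dense K" and X: "\<exists>g :: real \<Rightarrow> 'a. surj g"
  obtains g :: "real \<Rightarrow> ('a \<Rightarrow> real)" where "{f. bounded_linear f} \<subseteq> range g"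
proof -
  \<comment> \<open>Indexing separating functionals by the differences \<open>z = x - y\<close>
    bounds their number by that of the points. Index 0 gets the zero functional required for
    separation.\<close>
  have "\<exists>f :: 'a \<Rightarrow> real. bounded_linear f \<and> (z \<noteq> 0 \<longrightarrow> f z < 0) \<and> (z = 0 \<longrightarrow> f = (\<lambda>_. 0))" for z :: 'a
  proof (cases "z = 0")
    case True
    then show ?thesis using bounded_linear_zero by blast
  next
    case False
    then show ?thesis using ex_functional_neg[of z] by blast
  qed
  then obtain G :: "'a \<Rightarrow> 'a \<Rightarrow> real" where G: "\<And>z. bounded_linear (G z)"
    "\<And>z. z \<noteq> 0 \<Longrightarrow> G z z < 0" "G 0 = (\<lambda>_. 0)"
    by metis
  define separates where "separates f a b h \<longleftrightarrow> {x \<in> K. a \<le> f x} \<subseteq> halfspace_combination G h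
      \<and> {x \<in> K. f x \<le> b} \<inter> halfspace_combination G h = {}"
    for f :: "'a \<Rightarrow> real" and a b :: real and h
  have ex: "\<exists>h. separates f a b h" if f: "bounded_linear f" and less: "b < a" for f a b
  proof -
    have closed: "closedin weak_topology {x. f x \<in> V}" if "closed V" for V
      using continuous_map_weak_topology_functional[OF f] that
      by (auto simp: continuous_map_closedin)
    have "compactin weak_topology (K \<inter> {x. f x \<in> {a..}})" "compactin weak_topology (K \<inter> {x. f x \<in> {..b}})"
      by (intro compact_Int_closedin K closed; simp)+
    then have comp: "compactin weak_topology {x \<in> K. a \<le> f x}" "compactin weak_topology {x \<in> K. f x \<le> b}"
      by (simp_all add: Collect_conj_eq)
    have sep: "\<exists>z. G z x < G z y" if "x \<in> {x \<in> K. a \<le> f x}" "y \<in> {x \<in> K. f x \<le> b}" for x y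
    proof -
      have "x - y \<noteq> 0" using that less by auto
      then have "G (x - y) (x - y) < 0" by (rule G(2))
      moreover have "G (x - y) (x - y) = G (x - y) x - G (x - y) y"
        using G(1) by (intro linear_diff bounded_linear.linear)
      ultimately show ?thesis by (intro exI[of _ "x - y"]) simp
    qed
    obtain h where "{x \<in> K. a \<le> f x} \<subseteq> halfspace_combination G h"
      "{x \<in> K. f x \<le> b} \<inter> halfspace_combination G h = {}"
      using separate_compact_by_halfspaces[OF comp continuous_map_weak_topology_functional[OF G(1)] sep G(3)]
      by blast
    then show ?thesis unfolding separates_def by blast
  qed
  define H where "H f a b = (SOME h. separates f a b h)" for f a b
  have H: "separates f a b (H f a b)" if "bounded_linear f" "b < a" for f a b
    unfolding H_def using ex[OF that] by (rule someI_ex)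
  \<comment> \<open>The code lists the chosen separating data for all pairs of rationals; only pairs
    with \<open>b < a\<close> are consulted.\<close>
  define code where "code f n = (case from_nat n of (a, b) \<Rightarrow> H f (real_of_rat a) (real_of_rat b))" for f n
  have code_eq: "H f (real_of_rat a) (real_of_rat b) = code f (to_nat (a, b))" for f a b
    by (simp add: code_def)
  have not_less: "\<not> f x < f' x"
    if "code f = code f'" "bounded_linear f" "bounded_linear f'" "x \<in> K" for f f' x
  proof
    \<comment> \<open>For rationals \<open>b < a\<close> strictly between, the separating set of
      \<open>f'\<close> contains \<open>x\<close> and that of \<open>f\<close> does not, although
      equal codes make them the same set.\<close>
    assume "f x < f' x"
    then obtain b where b: "f x < real_of_rat b" "real_of_rat b < f' x"
      using of_rat_dense by blast
    then obtain a where a: "real_of_rat b < real_of_rat a" "real_of_rat a < f' x"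
      using of_rat_dense by blast
    have "x \<in> halfspace_combination G (H f' (real_of_rat a) (real_of_rat b))"
      using H[OF that(3) a(1)] a(2) that(4) by (auto simp: separates_def)
    moreover have "x \<notin> halfspace_combination G (H f (real_of_rat a) (real_of_rat b))"
      using H[OF that(2) a(1)] b(1) that(4) by (auto simp: separates_def)
    ultimately show False using that(1) by (simp add: code_eq)
  qed
  have inj: "inj_on code {f. bounded_linear f}"
  proof (rule inj_onI, clarify)
    fix f f' assume "bounded_linear f" "bounded_linear f'" "code f = code f'"
    then show "f = f'"
      using not_less[of f f'] not_less[of f' f]
      by (intro linearly_dense_ext[OF K(2)]) (auto simp: not_less_iff_gr_or_eq)
  qed
  \<comment> \<open>The three nested sequences are the pairs of rationals and the two indices of
    \<open>h\<close>.\<close>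
  obtain g :: "real \<Rightarrow> (nat \<Rightarrow> nat \<Rightarrow> nat \<Rightarrow> 'a \<times> real)" where g: "surj g"
    using surj_real_sequences[OF surj_real_sequences[OF surj_real_sequences[OF surj_real_Times[OF X]]]]
    by blast
  have "f \<in> range (\<lambda>r. inv_into {f. bounded_linear f} code (g r))" if "bounded_linear f" for f
  proof -
    obtain r where "code f = g r" using g by (metis surjD)
    then show ?thesis using that inv_into_f_f[OF inj, of f] by (intro range_eqI[of _ _ r]) auto
  qed
  then show ?thesis by (intro that) auto
qed

section \<open>Construction of the overcomplete set\<close>

text \<open>Strict initial segments of a cardinal well-order have smaller cardinality; under CH this
  means less than omega_1, hence countable.\<close>

lemma countable_initial_segment:
  assumes "CH"
  shows "countable {b. (b, a) \<in> card_of (UNIV :: real set)}"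
proof -
  let ?r = "card_of (UNIV :: real set)"
  have "ordLess2 (card_of (underS ?r a)) ?r"
    by (intro card_of_underS card_of_Card_order) (simp add: Field_card_of)
  then have "ordLess2 (card_of (underS ?r a)) omega1"
    using assms ordLess_ordIso_trans unfolding CH_def by blast
  then have "ordLeq3 (card_of (underS ?r a)) natLeq"
    using cardSuc_ordLeq_ordLess[OF natLeq_Card_order card_of_Card_order] by blast
  then have "ordLeq3 (card_of (underS ?r a)) (card_of (UNIV :: nat set))"
    using ordLeq_ordIso_trans card_of_nat ordIso_symmetric by blast
  then have "countable (underS ?r a)"
    by (auto simp: card_of_ordLeq[symmetric] countable_def)
  moreover have "{b. (b, a) \<in> ?r} \<subseteq> insert a (underS ?r a)"
    by (auto simp: underS_def)
  ultimately show ?thesis using countable_subset countable_insert by metis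
qed

theorem theorem4p5:
  assumes "CH"
    and "WCG TYPE('a::banach)"
    and "dens_eq_omega1 TYPE('a)"
  shows "\<exists>S :: 'a set. rel_weakly_compact S \<and> overcomplete S"
proof -
  obtain K :: "'a set" where K: "compactin weak_topology K" "linearly_dense K"
    using assms(2) by (auto simp: WCG_def)
  obtain D :: "'a set" where D: "closure D = UNIV" "ordIso2 (card_of D) omega1"
    using assms(3) by (auto simp: dens_eq_omega1_def)
  have "ordIso2 (card_of (UNIV :: real set)) (card_of D)"
    using assms(1) D(2) ordIso_symmetric ordIso_transitive unfolding CH_def by blast
  then obtain d where d: "bij_betw d (UNIV :: real set) D"
    using card_of_ordIso by blast
  have X: "\<exists>g :: real \<Rightarrow> 'a. surj g"
    using surj_real_if_dense[OF D(1), of d] d by (simp add: bij_betw_imp_surj_on)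
  obtain g :: "real \<Rightarrow> ('a \<Rightarrow> real)" where g: "{f. bounded_linear f} \<subseteq> range g"
    using dual_le_continuum[OF K X] .
  \<comment> \<open>Two distinct points of \<open>D\<close> yield a nonzero functional
    \<open>f0\<close>; distinct \<open>f0\<close>-values will keep the chosen points
    distinct.\<close>
  have "d 0 \<noteq> d 1" using d by (metis UNIV_I bij_betw_imp_inj_on inj_onD zero_neq_one)
  then obtain f0 :: "'a \<Rightarrow> real" where f0: "bounded_linear f0" "f0 (d 0 - d 1) < 0"
    using ex_functional_neg[of "d 0 - d 1"] by auto
  then have f0_nz: "f0 \<noteq> (\<lambda>_. 0)" by auto
  \<comment> \<open>This well-order of the reals provides the stages of the recursion; through
    \<open>g\<close>, the same reals index the functionals.\<close>
  define r where "r = card_of (UNIV :: real set)"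
  have wo: "well_order_on UNIV r" unfolding r_def by (rule card_of_well_order_on)
  then have refl: "(a, a) \<in> r" and total: "a \<noteq> b \<Longrightarrow> (a, b) \<in> r - Id \<or> (b, a) \<in> r - Id" for a b
    unfolding order_on_defs refl_on_def total_on_def by auto
  \<comment> \<open>Indices at which \<open>g\<close> is zero or not bounded linear impose no
    condition.\<close>
  define good where "good f \<longleftrightarrow> bounded_linear f \<and> f \<noteq> (\<lambda>_. 0)" for f :: "'a \<Rightarrow> real"
  define P where "P s a v \<longleftrightarrow> v \<in> power_combinations K
      \<and> (\<forall>b. (b, a) \<in> r \<longrightarrow> good (g b) \<longrightarrow> g b v \<noteq> 0) \<and> (\<forall>b. (b, a) \<in> r - Id \<longrightarrow> v \<noteq> s b)"
    for s :: "real \<Rightarrow> 'a" and a v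
  have "\<exists>s. \<forall>a. P s a (s a)"
  proof (rule dependent_wf_choice)
    show "wf (r - Id)" using wo by (simp add: well_order_on_def)
    show "P s a v = P s' a v" if "\<And>b. (b, a) \<in> r - Id \<Longrightarrow> s b = s' b" for s s' a v
      using that unfolding P_def by auto
    fix a :: real and s :: "real \<Rightarrow> 'a"
    define U where "U = {b. (b, a) \<in> r}"
    have U: "countable U" unfolding U_def r_def by (rule countable_initial_segment[OF assms(1)])
    \<comment> \<open>The first pairs forbid zeros of \<open>g b\<close>, the second forbid
      repeating \<open>s b\<close>. Stage \<open>a\<close> itself is included, with whatever value
      \<open>s a\<close> has so far, which keeps \<open>F\<close> nonempty.\<close>
    define F where "F = (\<lambda>b. (g b, 0)) ` {b \<in> U. good (g b)} \<union> (\<lambda>b. (f0, f0 (s b))) ` U"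
    have "countable F" using U by (auto simp: F_def intro: countable_subset[OF _ U])
    moreover have "F \<noteq> {}" using refl[of a] by (auto simp: F_def U_def)
    moreover have "bounded_linear f \<and> f \<noteq> (\<lambda>_. 0)" if "(f, c) \<in> F" for f c
      using that f0 f0_nz by (auto simp: F_def good_def)
    ultimately obtain v where v: "v \<in> power_combinations K" "\<And>f c. (f, c) \<in> F \<Longrightarrow> f v \<noteq> c"
      using power_combinations_avoid_countable[OF K, of F] by metis
    have "g b v \<noteq> 0" if "(b, a) \<in> r" "good (g b)" for b
      using that by (intro v(2)) (auto simp: F_def U_def)
    moreover have "v \<noteq> s b" if "(b, a) \<in> r - Id" for b
    proof -
      have "f0 v \<noteq> f0 (s b)" using that by (intro v(2)) (auto simp: F_def U_def)
      then show ?thesis by auto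
    qed
    ultimately show "\<exists>v. P s a v" using v(1) unfolding P_def by blast
  qed
  then obtain s where s: "\<And>a. P s a (s a)" by blast
  have "inj s"
  proof (rule injI, rule ccontr)
    fix a b assume "s a = s b" "a \<noteq> b"
    then show False using total[of a b] s[of a] s[of b] unfolding P_def by metis
  qed
  then have "ordIso2 (card_of (UNIV :: real set)) (card_of (range s))"
    using card_of_ordIso inj_on_imp_bij_betw by blast
  then have card_S: "ordIso2 (card_of (range s)) (card_of (UNIV :: real set))"
    by (rule ordIso_symmetric)
  have "linearly_dense L" if L: "L \<subseteq> range s" "ordIso2 (card_of L) (card_of (range s))" for L
  proof (rule ccontr)
    assume "\<not> linearly_dense L"
    then obtain f :: "'a \<Rightarrow> real" where f: "bounded_linear f" "f \<noteq> (\<lambda>_. 0)" "\<And>y. y \<in> L \<Longrightarrow> f y = 0"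
      using ex_functional_annihilating by blast
    obtain b where b: "f = g b" using f(1) g by blast
    \<comment> \<open>From stage \<open>b\<close> on, the chosen points avoid the kernel of
      \<open>g b\<close>, so \<open>L\<close> contains only points from the countably many stages
      before \<open>b\<close>.\<close>
    have "a \<in> {a. (a, b) \<in> r}" if "s a \<in> L" for a
    proof -
      have "(b, a) \<notin> r" using s[of a] f b that unfolding P_def good_def by metis
      then show ?thesis using total[of a b] refl by auto
    qed
    then have "L \<subseteq> s ` {a. (a, b) \<in> r}" using L(1) by blast
    moreover have "countable {a. (a, b) \<in> r}"
      unfolding r_def by (rule countable_initial_segment[OF assms(1)])
    ultimately have "countable L" using countable_subset countable_image by metis
    moreover have "ordIso2 (card_of L) (card_of (UNIV :: real set))"
      using L(2) card_S by (rule ordIso_transitive)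
    then have "\<exists>\<phi>. bij_betw \<phi> L (UNIV :: real set)"
      using card_of_ordIso by blast
    ultimately show False using uncountable_UNIV_real bij_betw_imp_surj_on countable_image by metis
  qed
  moreover have "ordIso2 (card_of (range s)) omega1"
    using card_S assms(1) unfolding CH_def by (rule ordIso_transitive)
  ultimately have "overcomplete (range s)" by (simp add: overcomplete_def)
  moreover have "rel_weakly_compact (range s)"
    using s unfolding P_def
    by (intro rel_weakly_compact_subset[OF weakly_compact_power_combinations[OF K(1)]]) auto
  ultimately show ?thesis by blast
qed

end
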